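(* Let $A$ be a set and let $(E,d,s,e_0,\cdot)$ be a monad on $A$ in $\mathbf{Mly}$. Let $\triangleright:A^*\times E\to E$ and $\triangleleft:A^*\times E\to A^*$ be the canonical extensions of $d$ and $s$. Then $(A^*,E;\triangleright,\triangleleft)$ is a matching pair of monoids; consequently the bicrossed product $E\bowtie A^*$ is defined, i.e. the set $E\times A^*$ is a monoid with identity $(e_0,[\,])$ and multiplication $$(x,as)\bullet(y,bs)=\big(x\cdot(as\triangleright y),\ (as\triangleleft y)\mathbin{+\!\!+}bs\big).$$
   Context: A monad on a set $A$ in the pseudo double category $\mathbf{Mly}$ of Mealy automata (in sets) consists of a set $E$ with functions $d:A\times E\to E$ and $s:A\times E\to A$, an element $e_0\in E$ and a binary operation $\cdot$ on $E$ such that $(E,\cdot,e_0)$ is a monoid and for all $a\in A$, $e,e'\in E$: $s(a,e_0)=a$; $d(a,e_0)=e_0$; $s(a,e\cdot e')=s(s(a,e),e')$; $d(a,e\cdot e')=d(a,e)\cdot d(s(a,e),e')$. $A^*$ is the free monoid of finite lists on $A$, with empty list $[\,]$, concatenation $\mathbin{+\!\!+}$ and cons $a::as$. The canonical extensions are defined recursively by $[\,]\triangleright e=e$, $(a::as)\triangleright e=d(a,as\triangleright e)$, and $[\,]\triangleleft e=[\,]$, $(a::as)\triangleleft e=s(a,as\triangleright e)::(as\triangleleft e)$. A matching pair of monoids $(G,H;\triangleright,\triangleleft)$ consists of monoids $G,H$, a left action $\triangleright:G\times H\to H$ of $G$ on the set $H$, and a right action $\triangleleft:G\times H\to G$ of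 $H$ on the set $G$, such that $g\triangleright 1_H=1_H$, $1_G\triangleleft h=1_G$, $g\triangleright(hh')=(g\triangleright h)\big((g\triangleleft h)\triangleright h'\big)$ and $(gg')\triangleleft h=\big(g\triangleleft(g'\triangleright h)\big)(g'\triangleleft h)$ for all $g,g'\in G$, $h,h'\in H$. Its bicrossed product $H\bowtie G$ is the monoid with carrier $H\times G$, identity $(1_H,1_G)$ and multiplication $(h,g)\bullet(h',g')=(h(g\triangleright h'),(g\triangleleft h')g')$. *)

theory Defs
  imports "HOL-Algebra.Group"
begin

text \<open>
  Actions are curried: \<open>l g h\<close> is $g \triangleright h$ and \<open>r g h\<close> is $g \triangleleft h$. In both,
  the first argument lies in \<open>G\<close> and the second in \<open>H\<close>, so in a right action the
  acting element comes second.
\<close>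

locale monoid_left_action = monoid G
  for G :: "('g, 'm) monoid_scheme" (structure) +
  fixes X :: "'x set"
    and l :: "'g \<Rightarrow> 'x \<Rightarrow> 'x"
  assumes left_closed: "l \<in> carrier G \<rightarrow> X \<rightarrow> X"
    and left_one: "x \<in> X \<Longrightarrow> l \<one> x = x"
    and left_mult: "\<lbrakk>g \<in> carrier G; g' \<in> carrier G; x \<in> X\<rbrakk> \<Longrightarrow> l (g \<otimes> g') x = l g (l g' x)"

locale monoid_right_action = monoid H
  for H :: "('h, 'm) monoid_scheme" (structure) +
  fixes X :: "'x set"
    and r :: "'x \<Rightarrow> 'h \<Rightarrow> 'x"
  assumes right_closed: "r \<in> X \<rightarrow> carrier H \<rightarrow> X"
    and right_one: "x \<in> X \<Longrightarrow> r x \<one> = x"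
    and right_mult: "\<lbrakk>x \<in> X; h \<in> carrier H; h' \<in> carrier H\<rbrakk> \<Longrightarrow> r x (h \<otimes> h') = r (r x h) h'"

locale matching_pair =
  left: monoid_left_action G "carrier H" l +
  right: monoid_right_action H "carrier G" r
  for G :: "('g, 'm) monoid_scheme"
    and H :: "('h, 'n) monoid_scheme"
    and l :: "'g \<Rightarrow> 'h \<Rightarrow> 'h"
    and r :: "'g \<Rightarrow> 'h \<Rightarrow> 'g" +
  assumes left_on_one: "g \<in> carrier G \<Longrightarrow> l g \<one>\<^bsub>H\<^esub> = \<one>\<^bsub>H\<^esub>"
    and right_on_one: "h \<in> carrier H \<Longrightarrow> r \<one>\<^bsub>G\<^esub> h = \<one>\<^bsub>G\<^esub>"
    and left_on_mult: "\<lbrakk>g \<in> carrier G; h \<in> carrier H; h' \<in> carrier H\<rbrakk> \<Longrightarrow>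
      l g (h \<otimes>\<^bsub>H\<^esub> h') = l g h \<otimes>\<^bsub>H\<^esub> l (r g h) h'"
    and right_on_mult: "\<lbrakk>g \<in> carrier G; g' \<in> carrier G; h \<in> carrier H\<rbrakk> \<Longrightarrow>
      r (g \<otimes>\<^bsub>G\<^esub> g') h = r g (l g' h) \<otimes>\<^bsub>G\<^esub> r g' h"

text \<open>The bicrossed product $H \bowtie G$; note that \<open>H\<close> comes first in the carrier.\<close>

definition bicrossed_product ::
  "('g, 'm) monoid_scheme \<Rightarrow> ('h, 'n) monoid_scheme \<Rightarrow> ('g \<Rightarrow> 'h \<Rightarrow> 'h) \<Rightarrow> ('g \<Rightarrow> 'h \<Rightarrow> 'g) \<Rightarrow>
    ('h \<times> 'g) monoid" where
  "bicrossed_product G H l r =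
    \<lparr>carrier = carrier H \<times> carrier G,
     mult = (\<lambda>(h, g) (h', g'). (h \<otimes>\<^bsub>H\<^esub> l g h', r g h' \<otimes>\<^bsub>G\<^esub> g')),
     one = (\<one>\<^bsub>H\<^esub>, \<one>\<^bsub>G\<^esub>)\<rparr>"

definition free_monoid :: "'a set \<Rightarrow> 'a list monoid" where
  "free_monoid A = \<lparr>carrier = lists A, mult = (@), one = []\<rparr>"

text \<open>
  A monad on the set \<open>A\<close> in the pseudo double category of Mealy automata, in its explicit
  form: the endo-automaton \<open>(E, d, s)\<close> on \<open>A\<close> has state set \<open>carrier E\<close>, and the unit and
  multiplication of the monad are the unit and multiplication of the monoid \<open>E\<close>.
\<close>

locale mly_monad = monoid E
  for A :: "'a set"
    and E :: "('e, 'm) monoid_scheme" (structure) +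
  fixes d :: "'a \<Rightarrow> 'e \<Rightarrow> 'e"
    and s :: "'a \<Rightarrow> 'e \<Rightarrow> 'a"
  assumes d_closed: "d \<in> A \<rightarrow> carrier E \<rightarrow> carrier E"
    and s_closed: "s \<in> A \<rightarrow> carrier E \<rightarrow> A"
    and s_one: "a \<in> A \<Longrightarrow> s a \<one> = a"
    and d_one: "a \<in> A \<Longrightarrow> d a \<one> = \<one>"
    and s_mult: "\<lbrakk>a \<in> A; e \<in> carrier E; e' \<in> carrier E\<rbrakk> \<Longrightarrow> s a (e \<otimes> e') = s (s a e) e'"
    and d_mult: "\<lbrakk>a \<in> A; e \<in> carrier E; e' \<in> carrier E\<rbrakk> \<Longrightarrow>
      d a (e \<otimes> e') = d a e \<otimes> d (s a e) e'"

primrec d_ext :: "('a \<Rightarrow> 'e \<Rightarrow> 'e) \<Rightarrow> 'a list \<Rightarrow> 'e \<Rightarrow> 'e" where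
  "d_ext d [] e = e"
| "d_ext d (a # as) e = d a (d_ext d as e)"

primrec s_ext :: "('a \<Rightarrow> 'e \<Rightarrow> 'e) \<Rightarrow> ('a \<Rightarrow> 'e \<Rightarrow> 'a) \<Rightarrow> 'a list \<Rightarrow> 'e \<Rightarrow> 'a list" where
  "s_ext d s [] e = []"
| "s_ext d s (a # as) e = s a (d_ext d as e) # s_ext d s as e"

end

theory Submission
  imports Defs
begin

text \<open>A word acts letter by letter from the right: each letter meets the element of
  \<open>E\<close> already transformed by the letters after it. Hence the laws about concatenation
  (\<open>d_ext_append\<close>, \<open>s_ext_append\<close>) are built into the recursion, while the
  laws about \<open>\<one>\<close> and \<open>\<otimes>\<close> of \<open>E\<close> hold for letters
  by the monad axioms and pass to words by induction (\<open>d_ext_mult\<close>,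
  \<open>s_ext_mult\<close>). The monoid on pairs is then the bicrossed product, which exists for
  every matching pair.\<close>

context matching_pair
begin

lemma left_mem: "g \<in> carrier G \<Longrightarrow> h \<in> carrier H \<Longrightarrow> l g h \<in> carrier H"
  using left.left_closed by (auto simp: Pi_iff)

lemma right_mem: "g \<in> carrier G \<Longrightarrow> h \<in> carrier H \<Longrightarrow> r g h \<in> carrier G"
  using right.right_closed by (auto simp: Pi_iff)

text \<open>For associativity, \<open>left_on_mult\<close> and \<open>left_mult\<close> match the
  \<open>H\<close>-components, \<open>right_on_mult\<close> and \<open>right_mult\<close> the
  \<open>G\<close>-components.\<close>

lemma monoid_bicrossed_product: "monoid (bicrossed_product G H l r)"
  by (unfold_locales)
    (auto simp: bicrossed_product_def left_mem right_mem left_on_one right_on_one left_on_mult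
      right_on_mult left.left_one left.left_mult right.right_one right.right_mult
      left.m_assoc right.m_assoc)

end

lemma monoid_free_monoid: "monoid (free_monoid A)"
  by unfold_locales (auto simp: free_monoid_def)

lemma d_ext_append: "d_ext d (as @ bs) e = d_ext d as (d_ext d bs e)"
  by (induction as) auto

lemma s_ext_append: "s_ext d s (as @ bs) e = s_ext d s as (d_ext d bs e) @ s_ext d s bs e"
  by (induction as) (auto simp: d_ext_append)

context mly_monad
begin

lemma d_mem: "a \<in> A \<Longrightarrow> e \<in> carrier E \<Longrightarrow> d a e \<in> carrier E"
  using d_closed by (auto simp: Pi_iff)

lemma s_mem: "a \<in> A \<Longrightarrow> e \<in> carrier E \<Longrightarrow> s a e \<in> A"
  using s_closed by (auto simp: Pi_iff)

lemma d_ext_mem: "as \<in> lists A \<Longrightarrow> e \<in> carrier E \<Longrightarrow> d_ext d as e \<in> carrier E"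
  by (induction as) (auto simp: d_mem)

lemma s_ext_mem: "as \<in> lists A \<Longrightarrow> e \<in> carrier E \<Longrightarrow> s_ext d s as e \<in> lists A"
  by (induction as) (auto simp: s_mem d_ext_mem)

lemma d_ext_one: "as \<in> lists A \<Longrightarrow> d_ext d as \<one> = \<one>"
  by (induction as) (auto simp: d_one)

lemma s_ext_one: "as \<in> lists A \<Longrightarrow> s_ext d s as \<one> = as"
  by (induction as) (auto simp: d_ext_one s_one)

text \<open>At \<open>a # as\<close> the induction hypothesis turns the argument of
  \<open>d a\<close> into a product; \<open>d_mult\<close> then passes from \<open>a\<close> to
  \<open>s a (d_ext d as e)\<close>, which is the head of
  \<open>s_ext d s (a # as) e\<close>.\<close>

lemma d_ext_mult:
  assumes "as \<in> lists A" "e \<in> carrier E" "e' \<in> carrier E"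
  shows "d_ext d as (e \<otimes> e') = d_ext d as e \<otimes> d_ext d (s_ext d s as e) e'"
  using assms by (induction as) (auto simp: d_mult d_ext_mem s_ext_mem[simplified])

text \<open>Heads agree by \<open>s_mult\<close> once \<open>d_ext_mult\<close> has split
  \<open>d_ext d as (e \<otimes> e')\<close>; tails agree by induction.\<close>

lemma s_ext_mult:
  assumes "as \<in> lists A" "e \<in> carrier E" "e' \<in> carrier E"
  shows "s_ext d s as (e \<otimes> e') = s_ext d s (s_ext d s as e) e'"
  using assms by (induction as) (auto simp: d_ext_mult s_mult d_ext_mem s_ext_mem[simplified])

lemma matching_pair_ext: "matching_pair (free_monoid A) E (d_ext d) (s_ext d s)"
proof -
  interpret F: monoid "free_monoid A"
    by (rule monoid_free_monoid)
  show ?thesis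
    \<comment> \<open>\<open>d_ext_append\<close> and \<open>s_ext_mult\<close> are the two action
      laws; \<open>d_ext_mult\<close> and \<open>s_ext_append\<close> are the compatibilities
      \<open>left_on_mult\<close> and \<open>right_on_mult\<close>.\<close>
    by unfold_locales
      (simp_all add: free_monoid_def d_ext_mem s_ext_mem[simplified] d_ext_one s_ext_one
        d_ext_mult s_ext_mult d_ext_append s_ext_append)
qed

end

theorem corollary13:
  fixes A :: "'a set"
    and E :: "('e, 'm) monoid_scheme"
    and d :: "'a \<Rightarrow> 'e \<Rightarrow> 'e"
    and s :: "'a \<Rightarrow> 'e \<Rightarrow> 'a"
  assumes "mly_monad A E d s"
  shows "matching_pair (free_monoid A) E (d_ext d) (s_ext d s) \<and>
    (let P = bicrossed_product (free_monoid A) E (d_ext d) (s_ext d s) in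
      monoid P \<and>
      carrier P = carrier E \<times> lists A \<and>
      \<one>\<^bsub>P\<^esub> = (\<one>\<^bsub>E\<^esub>, []) \<and>
      (\<forall>x \<in> carrier E. \<forall>y \<in> carrier E. \<forall>as \<in> lists A. \<forall>bs \<in> lists A.
        (x, as) \<otimes>\<^bsub>P\<^esub> (y, bs) = (x \<otimes>\<^bsub>E\<^esub> d_ext d as y, s_ext d s as y @ bs)))"
proof -
  interpret matching_pair "free_monoid A" E "d_ext d" "s_ext d s"
    using assms by (rule mly_monad.matching_pair_ext)
  show ?thesis
    using matching_pair_axioms monoid_bicrossed_product
    by (simp add: Let_def bicrossed_product_def free_monoid_def)
qed

end
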